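(* Let $(E;+,0,1)$ be a pseudo-effect algebra and let $n\ge 1$ be an integer. The following two statements are equivalent. (i) There exists an $(n+1)$-valued discrete state on $E$. (ii) There exist nonempty subsets $E_0,E_1,\ldots,E_n$ of $E$ such that (a) $E_i\cap E_j=\emptyset$ for all $i,j\in\{0,1,\ldots,n\}$ with $i\ne j$; (b) $E=E_0\cup E_1\cup\cdots\cup E_n$; (c) $E_i^{-}=E_i^{\sim}=E_{n-i}$ for every $i\in\{0,1,\ldots,n\}$; (d) if $x\in E_i$, $y\in E_j$ and $x+y$ exists in $E$, then $i+j\le n$ and $x+y\in E_{i+j}$, for $i,j\in\{0,1,\ldots,n\}$.
   Context: A pseudo-effect algebra (PEA) is a structure $(E;+,0,1)$ with a partial binary operation $+$ and constants $0,1$ such that for all $a,b,c\in E$: (PE1) $a+b$ and $(a+b)+c$ exist iff $b+c$ and $a+(b+c)$ exist, and then $(a+b)+c=a+(b+c)$; (PE2) there are exactly one $d\in E$ and exactly one $e\in E$ with $a+d=e+a=1$; (PE3) if $a+b$ exists, there are $d,e\in E$ with $a+b=d+a=b+e$; (PE4) if $a+1$ or $1+a$ exists, then $a=0$. It is assumed that $0\neq 1$. Write $a^{\sim}$ for the unique element with $a+a^{\sim}=1$ and $a^{-}$ for the unique element with $a^{-}+a=1$. For $A\subseteq E$ put $A^{-}=\{a^{-}\mid a\in A\}$ and $A^{\sim}=\{a^{\sim}\mid a\in A\}$. A state on $E$ is a map $s:E\to[0,1]$ with $s(0)=0$, $s(1)=1$ and $s(a+b)=s(a)+s(b)$ whenever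 $a+b$ exists in $E$. It is an $(n+1)$-valued discrete state if $s(E)=\{0,\frac1n,\ldots,\frac{n-1}{n},1\}$. *)

theory Defs
  imports Complex_Main
begin

text \<open>
  The partial operation is modelled by a function into an option type: \<open>padd a b = None\<close> means
  that the sum of \<open>a\<close> and \<open>b\<close> does not exist. Axioms constrain \<open>padd\<close> only on the carrier \<open>E\<close>.
\<close>

locale pseudo_effect_algebra =
  fixes E :: "'a set"
    and padd :: "'a \<Rightarrow> 'a \<Rightarrow> 'a option"
    and zero :: 'a
    and one :: 'a
  assumes padd_closed: "\<lbrakk>a \<in> E; b \<in> E; padd a b = Some c\<rbrakk> \<Longrightarrow> c \<in> E"
    and zero_closed: "zero \<in> E"
    and one_closed: "one \<in> E"
    and zero_neq_one: "zero \<noteq> one"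
    \<comment> \<open>Equality of the two binds: both iterated sums are undefined, or both exist and agree.\<close>
    and PE1: "\<lbrakk>a \<in> E; b \<in> E; c \<in> E\<rbrakk> \<Longrightarrow>
      Option.bind (padd a b) (\<lambda>u. padd u c) = Option.bind (padd b c) (\<lambda>v. padd a v)"
    and PE2: "a \<in> E \<Longrightarrow>
      (\<exists>!d. d \<in> E \<and> padd a d = Some one) \<and> (\<exists>!e. e \<in> E \<and> padd e a = Some one)"
    and PE3: "\<lbrakk>a \<in> E; b \<in> E; padd a b = Some c\<rbrakk> \<Longrightarrow>
      \<exists>d\<in>E. \<exists>e\<in>E. padd d a = Some c \<and> padd b e = Some c"
    and PE4: "\<lbrakk>a \<in> E; padd a one \<noteq> None \<or> padd one a \<noteq> None\<rbrakk> \<Longrightarrow> a = zero"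

text \<open>
  \<open>right_compl\<close> is $a^{\sim}$ and \<open>left_compl\<close> is $a^{-}$; both are well defined for \<open>a \<in> E\<close> by PE2.
\<close>

definition right_compl :: "'a set \<Rightarrow> ('a \<Rightarrow> 'a \<Rightarrow> 'a option) \<Rightarrow> 'a \<Rightarrow> 'a \<Rightarrow> 'a" where
  "right_compl E padd one a = (THE d. d \<in> E \<and> padd a d = Some one)"

definition left_compl :: "'a set \<Rightarrow> ('a \<Rightarrow> 'a \<Rightarrow> 'a option) \<Rightarrow> 'a \<Rightarrow> 'a \<Rightarrow> 'a" where
  "left_compl E padd one a = (THE e. e \<in> E \<and> padd e a = Some one)"

definition is_state ::
  "'a set \<Rightarrow> ('a \<Rightarrow> 'a \<Rightarrow> 'a option) \<Rightarrow> 'a \<Rightarrow> 'a \<Rightarrow> ('a \<Rightarrow> real) \<Rightarrow> bool" where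
  "is_state E padd zero one s \<longleftrightarrow>
     (\<forall>a\<in>E. s a \<in> {0..1}) \<and> s zero = 0 \<and> s one = 1 \<and>
     (\<forall>a\<in>E. \<forall>b\<in>E. \<forall>c. padd a b = Some c \<longrightarrow> s c = s a + s b)"

text \<open>The parameter \<open>n\<close> is one less than the number of values.\<close>

definition is_discrete_state ::
  "'a set \<Rightarrow> ('a \<Rightarrow> 'a \<Rightarrow> 'a option) \<Rightarrow> 'a \<Rightarrow> 'a \<Rightarrow> nat \<Rightarrow> ('a \<Rightarrow> real) \<Rightarrow> bool" where
  "is_discrete_state E padd zero one n s \<longleftrightarrow>
     is_state E padd zero one s \<and> s ` E = (\<lambda>k. real k / real n) ` {0..n}"

end

theory Submission
  imports Defs
begin

text \<open>
  A discrete state and a decomposition \<open>F 0, \<dots>, F n\<close> of \<open>E\<close> determine each other: \<open>F i\<close> is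
  the level set of the state at the value \<open>i / n\<close>.

  From a state to a decomposition, additivity shows that sums of elements of \<open>F i\<close> and \<open>F j\<close> lie in
  \<open>F (i + j)\<close>, and \<open>i + j \<le> n\<close> because the values of a state are at most \<open>1\<close>. Applied to the sums
  of an element with its complements, additivity also shows that both complements send the value
  \<open>t\<close> to \<open>1 - t\<close>. Since the two complements are mutually inverse bijections of \<open>E\<close>, they map the
  level set at \<open>t\<close> onto the one at \<open>1 - t\<close> (lemma \<open>compl_image_level\<close>).

  Conversely, call \<open>i\<close> the degree of the elements of \<open>F i\<close>, and let the state be the degree divided
  by \<open>n\<close>. Only the normalisation at the two constants needs an argument. As \<open>one + zero = one\<close>
  and degrees are additive, \<open>zero\<close> has degree \<open>0\<close>; as \<open>zero\<close> is the right complement of \<open>one\<close>,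
  it has degree \<open>n\<close> minus that of \<open>one\<close>, so \<open>one\<close> has degree \<open>n\<close>.
\<close>

context pseudo_effect_algebra
begin

lemma right_compl: "a \<in> E \<Longrightarrow>
    right_compl E padd one a \<in> E \<and> padd a (right_compl E padd one a) = Some one"
  unfolding right_compl_def using PE2 by (rule theI'[OF conjunct1])

lemma left_compl: "a \<in> E \<Longrightarrow>
    left_compl E padd one a \<in> E \<and> padd (left_compl E padd one a) a = Some one"
  unfolding left_compl_def using PE2 by (rule theI'[OF conjunct2])

lemma right_compl_eqI: "\<lbrakk>a \<in> E; b \<in> E; padd a b = Some one\<rbrakk> \<Longrightarrow> right_compl E padd one a = b"
  using PE2[of a] right_compl[of a] by blast

lemma left_compl_eqI: "\<lbrakk>a \<in> E; b \<in> E; padd b a = Some one\<rbrakk> \<Longrightarrow> left_compl E padd one a = b"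
  using PE2[of a] left_compl[of a] by blast

lemma left_compl_right_compl: "a \<in> E \<Longrightarrow> left_compl E padd one (right_compl E padd one a) = a"
  using right_compl[of a] by (blast intro: left_compl_eqI)

lemma right_compl_left_compl: "a \<in> E \<Longrightarrow> right_compl E padd one (left_compl E padd one a) = a"
  using left_compl[of a] by (blast intro: right_compl_eqI)

text \<open>By PE4, the right complement of \<open>one\<close>, being summable with \<open>one\<close>, can only be \<open>zero\<close>.\<close>

lemma padd_one_zero: "padd one zero = Some one"
proof -
  let ?d = "right_compl E padd one one"
  have d: "?d \<in> E" "padd one ?d = Some one"
    using right_compl[OF one_closed] by auto
  then have "?d = zero"
    using PE4[of ?d] by simp
  with d show ?thesis by simp
qed

lemma right_compl_one: "right_compl E padd one one = zero"
  by (rule right_compl_eqI[OF one_closed zero_closed padd_one_zero])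

lemma state_compl:
  assumes "is_state E padd zero one s" and "a \<in> E"
  shows "s (right_compl E padd one a) = 1 - s a" and "s (left_compl E padd one a) = 1 - s a"
proof -
  have add: "s one = s b + s c" if "b \<in> E" "c \<in> E" "padd b c = Some one" for b c
    using assms(1) that unfolding is_state_def by blast
  have "s one = 1"
    using assms(1) unfolding is_state_def by blast
  with add right_compl[OF assms(2)] left_compl[OF assms(2)] assms(2)
  show "s (right_compl E padd one a) = 1 - s a" and "s (left_compl E padd one a) = 1 - s a"
    by (smt (verit))+
qed

lemma compl_image_level:
  assumes s: "is_state E padd zero one s"
  shows "left_compl E padd one ` {a \<in> E. s a = t} = {a \<in> E. s a = 1 - t}"
    and "right_compl E padd one ` {a \<in> E. s a = t} = {a \<in> E. s a = 1 - t}"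
proof -
  show "left_compl E padd one ` {a \<in> E. s a = t} = {a \<in> E. s a = 1 - t}"
  proof (intro equalityI subsetI)
    fix b assume "b \<in> {a \<in> E. s a = 1 - t}"
    then show "b \<in> left_compl E padd one ` {a \<in> E. s a = t}"
      by (intro image_eqI[of _ _ "right_compl E padd one b"])
        (auto simp: left_compl_right_compl right_compl state_compl[OF s])
  qed (auto simp: left_compl state_compl[OF s])
  show "right_compl E padd one ` {a \<in> E. s a = t} = {a \<in> E. s a = 1 - t}"
  proof (intro equalityI subsetI)
    fix b assume "b \<in> {a \<in> E. s a = 1 - t}"
    then show "b \<in> right_compl E padd one ` {a \<in> E. s a = t}"
      by (intro image_eqI[of _ _ "left_compl E padd one b"])
        (auto simp: right_compl_left_compl left_compl state_compl[OF s])
  qed (auto simp: right_compl state_compl[OF s])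
qed

end

theorem theorem4p1:
  fixes E :: "'a set"
    and padd :: "'a \<Rightarrow> 'a \<Rightarrow> 'a option"
    and zero one :: 'a
    and n :: nat
  assumes "pseudo_effect_algebra E padd zero one"
    and "n \<ge> 1"
  shows "(\<exists>s :: 'a \<Rightarrow> real. is_discrete_state E padd zero one n s) \<longleftrightarrow>
    (\<exists>F :: nat \<Rightarrow> 'a set.
      (\<forall>i\<in>{0..n}. F i \<subseteq> E \<and> F i \<noteq> {}) \<and>
      (\<forall>i\<in>{0..n}. \<forall>j\<in>{0..n}. i \<noteq> j \<longrightarrow> F i \<inter> F j = {}) \<and>
      E = (\<Union>i\<in>{0..n}. F i) \<and>
      (\<forall>i\<in>{0..n}. left_compl E padd one ` F i = F (n - i) \<and>
                  right_compl E padd one ` F i = F (n - i)) \<and>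
      (\<forall>i\<in>{0..n}. \<forall>j\<in>{0..n}. \<forall>x\<in>F i. \<forall>y\<in>F j. \<forall>z.
         padd x y = Some z \<longrightarrow> i + j \<le> n \<and> z \<in> F (i + j)))"
proof -
  interpret pseudo_effect_algebra E padd zero one by fact
  have n: "real n > 0" using \<open>n \<ge> 1\<close> by simp
  show ?thesis
  proof (intro iffI; elim exE conjE)
    fix s :: "'a \<Rightarrow> real"
    assume "is_discrete_state E padd zero one n s"
    then have s: "is_state E padd zero one s"
      and range: "s ` E = (\<lambda>k. real k / real n) ` {0..n}"
      unfolding is_discrete_state_def by auto
    define F where "F i = {a \<in> E. s a = real i / real n}" for i
    have ne: "F i \<noteq> {}" if "i \<in> {0..n}" for i
    proof -
      have "real i / real n \<in> s ` E" using range that by blast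
      then show ?thesis unfolding F_def by force
    qed
    have disj: "F i \<inter> F j = {}" if "i \<noteq> j" for i j
      using that n unfolding F_def by auto
    have cover: "E = (\<Union>i\<in>{0..n}. F i)"
    proof (intro equalityI subsetI)
      fix x assume "x \<in> E"
      then have "s x \<in> (\<lambda>k. real k / real n) ` {0..n}" using range by blast
      with \<open>x \<in> E\<close> show "x \<in> (\<Union>i\<in>{0..n}. F i)" unfolding F_def by auto
    qed (auto simp: F_def)
    have compl: "left_compl E padd one ` F i = F (n - i) \<and>
        right_compl E padd one ` F i = F (n - i)" if "i \<in> {0..n}" for i
    proof -
      have "real (n - i) / real n = 1 - real i / real n"
        using that n by (simp add: of_nat_diff field_simps)
      then show ?thesis
        unfolding F_def by (simp add: compl_image_level[OF s])
    qed
    have add: "i + j \<le> n \<and> z \<in> F (i + j)"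
      if "x \<in> F i" "y \<in> F j" "padd x y = Some z" for i j x y z
    proof -
      have "x \<in> E" "y \<in> E" and sx: "s x = real i / real n" and sy: "s y = real j / real n"
        using that by (auto simp: F_def)
      have z: "z \<in> E" by (rule padd_closed) fact+
      have "s z = s x + s y"
        using s \<open>x \<in> E\<close> \<open>y \<in> E\<close> that(3) unfolding is_state_def by blast
      then have sz: "s z = real (i + j) / real n"
        by (simp add: sx sy add_divide_distrib)
      have "s z \<le> 1"
        using s z unfolding is_state_def by auto
      then have "real (i + j) \<le> real n"
        using n unfolding sz by (simp add: divide_le_eq)
      with z sz show ?thesis
        unfolding F_def by simp
    qed
    have sub: "F i \<subseteq> E" for i
      unfolding F_def by blast
    show "\<exists>F :: nat \<Rightarrow> 'a set.
      (\<forall>i\<in>{0..n}. F i \<subseteq> E \<and> F i \<noteq> {}) \<and>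
      (\<forall>i\<in>{0..n}. \<forall>j\<in>{0..n}. i \<noteq> j \<longrightarrow> F i \<inter> F j = {}) \<and>
      E = (\<Union>i\<in>{0..n}. F i) \<and>
      (\<forall>i\<in>{0..n}. left_compl E padd one ` F i = F (n - i) \<and>
                  right_compl E padd one ` F i = F (n - i)) \<and>
      (\<forall>i\<in>{0..n}. \<forall>j\<in>{0..n}. \<forall>x\<in>F i. \<forall>y\<in>F j. \<forall>z.
         padd x y = Some z \<longrightarrow> i + j \<le> n \<and> z \<in> F (i + j))"
      proof (intro exI[of _ F] conjI)
      show "\<forall>i\<in>{0..n}. F i \<subseteq> E \<and> F i \<noteq> {}"
        using sub ne by simp
      show "\<forall>i\<in>{0..n}. \<forall>j\<in>{0..n}. i \<noteq> j \<longrightarrow> F i \<inter> F j = {}"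
        using disj by simp
      show "E = (\<Union>i\<in>{0..n}. F i)"
        by (rule cover)
      show "\<forall>i\<in>{0..n}. left_compl E padd one ` F i = F (n - i) \<and>
                  right_compl E padd one ` F i = F (n - i)"
        using compl by simp
      show "\<forall>i\<in>{0..n}. \<forall>j\<in>{0..n}. \<forall>x\<in>F i. \<forall>y\<in>F j. \<forall>z.
         padd x y = Some z \<longrightarrow> i + j \<le> n \<and> z \<in> F (i + j)"
        using add by simp
    qed
  next
    fix F :: "nat \<Rightarrow> 'a set"
    assume nonempty: "\<forall>i\<in>{0..n}. F i \<subseteq> E \<and> F i \<noteq> {}"
      and disjoint: "\<forall>i\<in>{0..n}. \<forall>j\<in>{0..n}. i \<noteq> j \<longrightarrow> F i \<inter> F j = {}"
      and union: "E = (\<Union>i\<in>{0..n}. F i)"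
      and compl: "\<forall>i\<in>{0..n}. left_compl E padd one ` F i = F (n - i) \<and>
                  right_compl E padd one ` F i = F (n - i)"
      and sums: "\<forall>i\<in>{0..n}. \<forall>j\<in>{0..n}. \<forall>x\<in>F i. \<forall>y\<in>F j. \<forall>z.
         padd x y = Some z \<longrightarrow> i + j \<le> n \<and> z \<in> F (i + j)"
    have sub: "x \<in> E" if "x \<in> F i" "i \<le> n" for x i
      using nonempty that by auto
    have uniq: "i = j" if "x \<in> F i" "x \<in> F j" "i \<le> n" "j \<le> n" for x i j
      using disjoint that by fastforce
    have cover: "\<exists>i\<le>n. x \<in> F i" if "x \<in> E" for x
    proof -
      have "x \<in> (\<Union>i\<in>{0..n}. F i)" unfolding union[symmetric] by (rule that)
      then show ?thesis by auto
    qed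
    have rcompl: "right_compl E padd one ` F i = F (n - i)" if "i \<le> n" for i
      using compl that by simp
    have add: "i + j \<le> n \<and> z \<in> F (i + j)"
      if "x \<in> F i" "y \<in> F j" "padd x y = Some z" "i \<le> n" "j \<le> n" for i j x y z
      using sums that by simp
    \<comment> \<open>The degree of an element is the index of the member of the decomposition containing it.\<close>
    define deg where "deg x = (THE i. i \<le> n \<and> x \<in> F i)" for x
    have deg_eqI: "deg x = i" if "x \<in> F i" "i \<le> n" for x i
      unfolding deg_def using that uniq by (intro the_equality) auto
    have deg: "deg x \<le> n" "x \<in> F (deg x)" if "x \<in> E" for x
      using cover[OF that] deg_eqI by auto
    have deg_add: "deg z = deg x + deg y" if "x \<in> E" "y \<in> E" "padd x y = Some z" for x y z
      using add[OF deg(2)[OF that(1)] deg(2)[OF that(2)] that(3) deg(1)[OF that(1)] deg(1)[OF that(2)]]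
      by (simp add: deg_eqI)
    have deg_zero: "deg zero = 0"
      using deg_add[OF one_closed zero_closed padd_one_zero] by simp
    have "zero \<in> F (n - deg one)"
      using imageI[OF deg(2)[OF one_closed], of "right_compl E padd one"]
      by (simp only: right_compl_one rcompl[OF deg(1)[OF one_closed]])
    then have "deg zero = n - deg one"
      by (simp add: deg_eqI)
    then have deg_one: "deg one = n"
      using deg_zero deg(1)[OF one_closed] by simp
    have "deg ` E = {0..n}"
    proof (intro equalityI subsetI)
      fix i assume "i \<in> {0..n}"
      then obtain x where "x \<in> F i" "i \<le> n" using nonempty by fastforce
      then show "i \<in> deg ` E" by (auto intro!: image_eqI[of _ _ x] simp: sub deg_eqI)
    qed (use deg(1) in auto)
    then have "(\<lambda>x. real (deg x) / real n) ` E = (\<lambda>k. real k / real n) ` {0..n}"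
      by (simp flip: image_image[of "\<lambda>k. real k / real n" deg])
    moreover have "is_state E padd zero one (\<lambda>x. real (deg x) / real n)"
      unfolding is_state_def using n
      by (auto simp: deg_zero deg_one deg(1) deg_add add_divide_distrib)
    ultimately show "\<exists>s :: 'a \<Rightarrow> real. is_discrete_state E padd zero one n s"
      unfolding is_discrete_state_def by blast
  qed
qed

end
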